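(* Let $f,f',g$ and $g'$ be multi-valued functions on represented spaces. If $f\leq_{\mathrm W}g$ and $f'\leq_{\mathrm W}g'$, then $f\times f'\leq_{\mathrm W}g\times g'$. The analogous statement holds for strong Weihrauch reducibility: if $f\leq_{\mathrm{sW}}g$ and $f'\leq_{\mathrm{sW}}g'$, then $f\times f'\leq_{\mathrm{sW}}g\times g'$.
   Context: A represented space $(X,\delta_X)$ is a set $X$ with a surjective partial map $\delta_X:\subseteq\mathbb{N}^{\mathbb{N}}\to X$. A multi-valued function $f:\subseteq X\rightrightarrows Y$ assigns to each $x$ a set $f(x)\subseteq Y$, with $\mathrm{dom}(f)=\{x: f(x)\neq\emptyset\}$. A realizer of $f$ is a partial $F:\subseteq\mathbb{N}^{\mathbb{N}}\to\mathbb{N}^{\mathbb{N}}$ such that $F(p)$ is defined and $\delta_YF(p)\in f(\delta_X(p))$ whenever $\delta_X(p)\in\mathrm{dom}(f)$. $f\leq_{\mathrm W}g$ iff there are computable $H,K:\subseteq\mathbb{N}^{\mathbb{N}}\to\mathbb{N}^{\mathbb{N}}$ such that for every realizer $G$ of $g$ the function $p\mapsto H\langle p,GK(p)\rangle$ is a realizer of $f$, where $\langle\cdot,\cdot\rangle$ is a computable pairing on $\mathbb{N}^{\mathbb{N}}$. $f\leq_{\mathrm{sW}}g$ is defined in the same way with $H\circ G\circ K$ in place of $p\mapsto H\langle p,GK(p)\rangle$. Product: for $f:\subseteq X\rightrightarrows Y$, $g:\subseteq U\rightrightarrows V$, $f\times g:\subseteq X\times U\rightrightarrows Y\times V$, $(f\times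 g)(x,u)=f(x)\times g(u)$ on $\mathrm{dom}(f)\times\mathrm{dom}(g)$; products carry the representation $[\delta_X,\delta_U]\langle p,q\rangle=(\delta_X(p),\delta_U(q))$. *)

theory Defs
  imports Main
begin

section \<open>Computable functions on Baire space\<close>

type_synonym baire = "nat \<Rightarrow> nat"

text \<open>
  Type-2 computability is expressed by programs for partial recursive functions relative to an
  oracle: the standard schemes, together with a call to an oracle in Baire space.
\<close>

datatype oprog =
    Zero
  | Succ
  | Proj nat
  | Oracle
  | Comp oprog "oprog list"
  | PrimRec oprog oprog
  | Mu oprog

text \<open>
  \<open>eval p e xs y\<close>: with oracle \<open>p\<close>, program \<open>e\<close> halts on the arguments \<open>xs\<close> with output \<open>y\<close>.
  On an argument list of unsuitable length a program diverges.
\<close>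

inductive eval :: "baire \<Rightarrow> oprog \<Rightarrow> nat list \<Rightarrow> nat \<Rightarrow> bool" for p :: baire where
  eval_Zero: "eval p Zero xs 0"
| eval_Succ: "eval p Succ [x] (Suc x)"
| eval_Proj: "i < length xs \<Longrightarrow> eval p (Proj i) xs (xs ! i)"
| eval_Oracle: "eval p Oracle [x] (p x)"
| eval_Comp: "list_all2 (\<lambda>g y. eval p g xs y) gs ys \<Longrightarrow> eval p f ys z
    \<Longrightarrow> eval p (Comp f gs) xs z"
| eval_PrimRec_0: "eval p f xs y \<Longrightarrow> eval p (PrimRec f g) (0 # xs) y"
| eval_PrimRec_Suc: "eval p (PrimRec f g) (n # xs) y \<Longrightarrow> eval p g (n # y # xs) z
    \<Longrightarrow> eval p (PrimRec f g) (Suc n # xs) z"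
| eval_Mu: "eval p f (n # xs) 0 \<Longrightarrow> (\<forall>m<n. \<exists>k. eval p f (m # xs) (Suc k))
    \<Longrightarrow> eval p (Mu f) xs n"

lemma eval_deterministic:
  "eval p e xs y \<Longrightarrow> eval p e xs z \<Longrightarrow> y = z"
proof (induction arbitrary: z rule: eval.induct)
  case (eval_Zero xs)
  then show ?case by (cases rule: eval.cases) auto
next
  case (eval_Succ x)
  then show ?case by (cases rule: eval.cases) auto
next
  case (eval_Proj i xs)
  from eval_Proj.prems show ?case by (cases rule: eval.cases) auto
next
  case (eval_Oracle x)
  then show ?case by (cases rule: eval.cases) auto
next
  case (eval_Comp xs gs ys f w)
  from eval_Comp.prems obtain ys' where
    ys': "list_all2 (\<lambda>g y. eval p g xs y) gs ys'" "eval p f ys' z"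
    by (cases rule: eval.cases) auto
  have "ys = ys'"
    using eval_Comp.IH(1) ys'(1) by (auto simp: list_all2_conv_all_nth intro: nth_equalityI)
  with ys'(2) eval_Comp.IH(2) show ?case by blast
next
  case (eval_PrimRec_0 f xs y g)
  from eval_PrimRec_0.prems have "eval p f xs z" by (cases rule: eval.cases) auto
  then show ?case by (rule eval_PrimRec_0.IH)
next
  case (eval_PrimRec_Suc f g n xs y w)
  from eval_PrimRec_Suc.prems obtain y' where
    "eval p (PrimRec f g) (n # xs) y'" "eval p g (n # y' # xs) z"
    by (cases rule: eval.cases) auto
  then show ?case using eval_PrimRec_Suc.IH by blast
next
  case (eval_Mu f n xs)
  from eval_Mu.prems have z: "eval p f (z # xs) 0" "\<forall>m<z. \<exists>k. eval p f (m # xs) (Suc k)"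
    by (cases rule: eval.cases; auto)+
  show ?case
  proof (rule linorder_cases[of n z])
    assume "n < z"
    with z(2) obtain k where "eval p f (n # xs) (Suc k)" by blast
    with eval_Mu.IH(1) show ?thesis by blast
  next
    assume "z < n"
    with eval_Mu.IH(2) z(1) show ?thesis by blast
  qed
qed

text \<open>
  A partial function on Baire space is computable if some program computes its value on every
  element of its domain; as usual in computable analysis, nothing is required of the program
  outside the domain.
\<close>

definition computable :: "(baire \<rightharpoonup> baire) \<Rightarrow> bool" where
  "computable F \<longleftrightarrow> (\<exists>e. \<forall>p q. F p = Some q \<longrightarrow> (\<forall>n. eval p e [n] (q n)))"

definition bpair :: "baire \<Rightarrow> baire \<Rightarrow> baire" where
  "bpair p q = (\<lambda>n. if even n then p (n div 2) else q (n div 2))"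

definition bfst :: "baire \<Rightarrow> baire" where
  "bfst r = (\<lambda>n. r (2 * n))"

definition bsnd :: "baire \<Rightarrow> baire" where
  "bsnd r = (\<lambda>n. r (2 * n + 1))"

lemma bfst_bpair [simp]: "bfst (bpair p q) = p"
  by (simp add: bfst_def bpair_def)

lemma bsnd_bpair [simp]: "bsnd (bpair p q) = q"
  by (simp add: bsnd_def bpair_def)

lemma bpair_bfst_bsnd [simp]: "bpair (bfst r) (bsnd r) = r"
  by (auto simp: bpair_def bfst_def bsnd_def)


section \<open>Represented spaces and multi-valued functions\<close>

record 'a rspace =
  points :: "'a set"
  rep :: "baire \<rightharpoonup> 'a"

definition represented_space :: "'a rspace \<Rightarrow> bool" where
  "represented_space X \<longleftrightarrow> ran (rep X) = points X"

definition prod_space :: "'a rspace \<Rightarrow> 'b rspace \<Rightarrow> ('a \<times> 'b) rspace" where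
  "prod_space X U =
    \<lparr>points = points X \<times> points U,
     rep = (\<lambda>r. case rep X (bfst r) of None \<Rightarrow> None
        | Some x \<Rightarrow> (case rep U (bsnd r) of None \<Rightarrow> None | Some u \<Rightarrow> Some (x, u)))\<rparr>"

lemma rep_prod_space_bpair:
  "rep (prod_space X U) (bpair p q) = Some (x, u) \<longleftrightarrow> rep X p = Some x \<and> rep U q = Some u"
  by (auto simp: prod_space_def split: option.splits)

lemma represented_space_prod_space:
  assumes "represented_space X" and "represented_space U"
  shows "represented_space (prod_space X U)"
proof -
  have "(x, u) \<in> ran (rep (prod_space X U))" if "x \<in> points X" "u \<in> points U" for x u
    using assms that rep_prod_space_bpair[of X U]
    by (fastforce simp: represented_space_def ran_def)
  moreover have "ran (rep (prod_space X U)) \<subseteq> points X \<times> points U"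
  proof clarify
    fix x u assume "(x, u) \<in> ran (rep (prod_space X U))"
    then obtain r where "rep (prod_space X U) r = Some (x, u)"
      by (auto simp: ran_def)
    then have "rep X (bfst r) = Some x" "rep U (bsnd r) = Some u"
      using rep_prod_space_bpair[of X U "bfst r" "bsnd r" x u] by simp_all
    then show "x \<in> points X \<and> u \<in> points U"
      using assms by (auto simp: represented_space_def intro: ranI)
  qed
  ultimately show ?thesis
    by (auto simp: represented_space_def prod_space_def)
qed

text \<open>
  A multi-valued function is given by its set of values at each point. Points of the ambient type
  outside the source space get no values, so that the domain lies in the source space.
\<close>

definition mv_dom :: "('a \<Rightarrow> 'b set) \<Rightarrow> 'a set" where
  "mv_dom f = {x. f x \<noteq> {}}"

definition mv_function :: "'a rspace \<Rightarrow> 'b rspace \<Rightarrow> ('a \<Rightarrow> 'b set) \<Rightarrow> bool" where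
  "mv_function X Y f \<longleftrightarrow> mv_dom f \<subseteq> points X \<and> (\<forall>x. f x \<subseteq> points Y)"

definition mv_prod :: "('a \<Rightarrow> 'b set) \<Rightarrow> ('c \<Rightarrow> 'd set) \<Rightarrow> 'a \<times> 'c \<Rightarrow> ('b \<times> 'd) set" where
  "mv_prod f g = (\<lambda>(x, u). f x \<times> g u)"

lemma mv_dom_mv_prod: "mv_dom (mv_prod f g) = mv_dom f \<times> mv_dom g"
  by (auto simp: mv_dom_def mv_prod_def)

lemma mv_function_mv_prod:
  assumes "mv_function X Y f" and "mv_function U V g"
  shows "mv_function (prod_space X U) (prod_space Y V) (mv_prod f g)"
  using assms unfolding mv_function_def mv_dom_mv_prod
  by (auto simp: mv_prod_def prod_space_def)


section \<open>Weihrauch reducibility\<close>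

definition realizer ::
    "'a rspace \<Rightarrow> 'b rspace \<Rightarrow> ('a \<Rightarrow> 'b set) \<Rightarrow> (baire \<rightharpoonup> baire) \<Rightarrow> bool" where
  "realizer X Y f F \<longleftrightarrow>
    (\<forall>p x. rep X p = Some x \<and> x \<in> mv_dom f \<longrightarrow>
      (\<exists>q y. F p = Some q \<and> rep Y q = Some y \<and> y \<in> f x))"

definition weihrauch_le ::
    "'a rspace \<Rightarrow> 'b rspace \<Rightarrow> ('a \<Rightarrow> 'b set) \<Rightarrow>
     'c rspace \<Rightarrow> 'd rspace \<Rightarrow> ('c \<Rightarrow> 'd set) \<Rightarrow> bool" where
  "weihrauch_le X Y f U V g \<longleftrightarrow>
    (\<exists>H K. computable H \<and> computable K \<and>
      (\<forall>G. realizer U V g G \<longrightarrow>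
        realizer X Y f (H \<circ>\<^sub>m (\<lambda>p. map_option (bpair p) ((G \<circ>\<^sub>m K) p)))))"

definition strong_weihrauch_le ::
    "'a rspace \<Rightarrow> 'b rspace \<Rightarrow> ('a \<Rightarrow> 'b set) \<Rightarrow>
     'c rspace \<Rightarrow> 'd rspace \<Rightarrow> ('c \<Rightarrow> 'd set) \<Rightarrow> bool" where
  "strong_weihrauch_le X Y f U V g \<longleftrightarrow>
    (\<exists>H K. computable H \<and> computable K \<and>
      (\<forall>G. realizer U V g G \<longrightarrow> realizer X Y f (H \<circ>\<^sub>m G \<circ>\<^sub>m K)))"

end

theory Submission
  imports Defs
begin

text \<open>
  A reduction of \<open>f\<close> to \<open>g\<close> and one of \<open>f'\<close> to \<open>g'\<close> can be run side by side: split a name of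
  a pair into its two halves, apply the two pre-processors, hand the resulting pair of names to a
  realizer of \<open>g \<times> g'\<close>, split the answer and apply the two post-processors. Two points need
  an argument.

  First, a realizer of \<open>g \<times> g'\<close> is not a pair of realizers: each half of its answer may depend on
  both halves of the input, so the hypotheses, which speak of realizers of \<open>g\<close> and of \<open>g'\<close>, do
  not apply directly. The remedy is to eliminate realizers. As realizers are arbitrary set-theoretic
  functions, any correct answer at a single name is the answer of some realizer, and a realizer
  may diverge outside the names of points of the domain. Hence the condition on
  all realizers is equivalent to a condition on single names: the pre-processor yields a name of
  a point in \<open>mv_dom g\<close>, and the post-processor is correct on every name of every value at that
  point (\<open>transforms_realizers_iff\<close>). In this form the condition is visibly compatible with
  products (\<open>namewise_reduction_prod\<close>).

  Secondly, the combined processors must be computable. Programs use the oracle only through calls,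
  so replacing each call by a program that computes the new oracle gives closure under composition
  (\<open>computable_map_comp\<close>); closure under pairing (\<open>computable_bpair_opt\<close>) needs only programs
  for parity, halving and selection.
\<close>

section \<open>Programs for elementary arithmetic\<close>

definition add_prog :: oprog where
  "add_prog = PrimRec (Proj 0) (Comp Succ [Proj 1])"

definition double_prog :: oprog where
  "double_prog = Comp add_prog [Proj 0, Proj 0]"

definition not_prog :: oprog where
  "not_prog = PrimRec (Comp Succ [Zero]) Zero"

definition parity_prog :: oprog where
  "parity_prog = PrimRec Zero (Comp not_prog [Proj 1])"

text \<open>The recursion rests on \<open>Suc n div 2 = n div 2 + n mod 2\<close>.\<close>

definition half_prog :: oprog where
  "half_prog = PrimRec Zero (Comp add_prog [Proj 1, Comp parity_prog [Proj 0]])"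

definition select_prog :: oprog where
  "select_prog = PrimRec (Proj 0) (Proj 3)"

lemma eval_ProjI: "i < length xs \<Longrightarrow> y = xs ! i \<Longrightarrow> eval p (Proj i) xs y"
  by (simp add: eval_Proj)

lemma eval_Comp1: "eval p g xs y \<Longrightarrow> eval p f [y] z \<Longrightarrow> eval p (Comp f [g]) xs z"
  by (rule eval_Comp[where ys = "[y]"]) simp_all

lemma eval_Comp2:
  "eval p g xs y \<Longrightarrow> eval p h xs w \<Longrightarrow> eval p f [y, w] z \<Longrightarrow> eval p (Comp f [g, h]) xs z"
  by (rule eval_Comp[where ys = "[y, w]"]) simp_all

lemma eval_Comp3:
  "eval p g xs y \<Longrightarrow> eval p h xs w \<Longrightarrow> eval p k xs v \<Longrightarrow> eval p f [y, w, v] z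
    \<Longrightarrow> eval p (Comp f [g, h, k]) xs z"
  by (rule eval_Comp[where ys = "[y, w, v]"]) simp_all

lemma eval_add_prog: "eval p add_prog [m, n] (m + n)"
proof (induction m)
  case 0
  show ?case
    unfolding add_prog_def by (auto intro!: eval_PrimRec_0 eval_ProjI)
next
  case (Suc m)
  have "eval p (Comp Succ [Proj 1]) [m, m + n, n] (Suc (m + n))"
    by (rule eval_Comp1[OF eval_ProjI eval_Succ]) simp_all
  with Suc show ?case
    unfolding add_prog_def by (auto intro: eval_PrimRec_Suc)
qed

lemma eval_double_prog: "eval p double_prog [n] (2 * n)"
proof -
  have "eval p double_prog [n] (n + n)"
    unfolding double_prog_def
    by (rule eval_Comp2[OF eval_ProjI eval_ProjI eval_add_prog]) simp_all
  then show ?thesis by (simp add: mult_2)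
qed

lemma eval_not_prog: "eval p not_prog [n] (if n = 0 then 1 else 0)"
proof (induction n)
  case 0
  have "eval p (Comp Succ [Zero]) [] (Suc 0)"
    by (rule eval_Comp1[OF eval_Zero eval_Succ])
  then show ?case unfolding not_prog_def by (simp add: eval_PrimRec_0)
next
  case (Suc n)
  then show ?case
    unfolding not_prog_def by (auto intro: eval_PrimRec_Suc eval_Zero)
qed

lemma eval_parity_prog: "eval p parity_prog [n] (n mod 2)"
proof (induction n)
  case 0
  show ?case unfolding parity_prog_def by (auto intro: eval_PrimRec_0 eval_Zero)
next
  case (Suc n)
  have "eval p (Comp not_prog [Proj 1]) [n, n mod 2] (if n mod 2 = 0 then 1 else 0)"
    by (rule eval_Comp1[OF eval_ProjI eval_not_prog]) simp_all
  moreover have "(if n mod 2 = 0 then 1 else 0) = Suc n mod 2"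
    by presburger
  ultimately show ?case
    using Suc unfolding parity_prog_def by (auto intro: eval_PrimRec_Suc)
qed

lemma eval_half_prog: "eval p half_prog [n] (n div 2)"
proof (induction n)
  case 0
  show ?case unfolding half_prog_def by (auto intro: eval_PrimRec_0 eval_Zero)
next
  case (Suc n)
  have "eval p (Comp parity_prog [Proj 0]) [n, n div 2] (n mod 2)"
    by (rule eval_Comp1[OF eval_ProjI eval_parity_prog]) simp_all
  then have "eval p (Comp add_prog [Proj 1, Comp parity_prog [Proj 0]]) [n, n div 2]
      (n div 2 + n mod 2)"
    by (rule eval_Comp2[OF eval_ProjI _ eval_add_prog, rotated 2]) simp_all
  moreover have "n div 2 + n mod 2 = Suc n div 2"
    by presburger
  ultimately show ?case
    using Suc unfolding half_prog_def by (auto intro: eval_PrimRec_Suc)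
qed

lemma eval_select_prog: "eval p select_prog [c, a, b] (if c = 0 then a else b)"
proof (induction c)
  case 0
  show ?case
    unfolding select_prog_def by (auto intro!: eval_PrimRec_0 eval_ProjI)
next
  case (Suc c)
  have "eval p (Proj 3) [c, if c = 0 then a else b, a, b] b"
    by (rule eval_ProjI) simp_all
  with Suc show ?case
    unfolding select_prog_def by (auto intro: eval_PrimRec_Suc)
qed


section \<open>Closure properties of computable functions\<close>

primrec subst_oracle :: "oprog \<Rightarrow> oprog \<Rightarrow> oprog" where
  "subst_oracle d Zero = Zero"
| "subst_oracle d Succ = Succ"
| "subst_oracle d (Proj i) = Proj i"
| "subst_oracle d Oracle = d"
| "subst_oracle d (Comp f gs) = Comp (subst_oracle d f) (map (subst_oracle d) gs)"
| "subst_oracle d (PrimRec f g) = PrimRec (subst_oracle d f) (subst_oracle d g)"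
| "subst_oracle d (Mu f) = Mu (subst_oracle d f)"

text \<open>
  One implication is all that composition requires: on the domain of a
  computable function its program halts, so only halting runs have to be transferred. The converse
  fails in general, since \<open>d\<close> may halt on argument lists where an oracle call diverges.
\<close>

lemma eval_subst_oracle:
  assumes d: "\<And>n. eval r d [n] (p n)"
  shows "eval p e xs y \<Longrightarrow> eval r (subst_oracle d e) xs y"
proof (induction rule: eval.induct)
  case (eval_Comp xs gs ys f z)
  have "list_all2 (\<lambda>g y. eval r g xs y) (map (subst_oracle d) gs) ys"
    using eval_Comp.IH(1) by (auto simp: list_all2_conv_all_nth)
  with eval_Comp.IH(2) show ?case by (auto intro: eval.eval_Comp)
next
  case (eval_Mu f n xs)
  then show ?case by (fastforce intro: eval.eval_Mu)
qed (auto intro: eval.intros d)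

lemma computable_map_comp:
  assumes "computable F" and "computable G"
  shows "computable (F \<circ>\<^sub>m G)"
proof -
  obtain e where e: "\<And>q s n. F q = Some s \<Longrightarrow> eval q e [n] (s n)"
    using assms(1) unfolding computable_def by blast
  obtain d where d: "\<And>p q n. G p = Some q \<Longrightarrow> eval p d [n] (q n)"
    using assms(2) unfolding computable_def by blast
  have "eval p (subst_oracle d e) [n] (s n)" if "(F \<circ>\<^sub>m G) p = Some s" for p s n
  proof -
    from that obtain q where q: "G p = Some q" "F q = Some s"
      by (auto simp: map_comp_Some_iff)
    show ?thesis
      using eval_subst_oracle[OF d[OF q(1)] e[OF q(2)]] .
  qed
  then show ?thesis unfolding computable_def by blast
qed

lemma computable_bfst: "computable (\<lambda>r. Some (bfst r))"
proof -
  have "eval r (Comp Oracle [double_prog]) [n] (bfst r n)" for r n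
    unfolding bfst_def by (rule eval_Comp1[OF eval_double_prog eval_Oracle])
  then show ?thesis unfolding computable_def by auto
qed

lemma computable_bsnd: "computable (\<lambda>r. Some (bsnd r))"
proof -
  have "eval r (Comp Oracle [Comp Succ [double_prog]]) [n] (bsnd r n)" for r n
    unfolding bsnd_def Suc_eq_plus1[symmetric]
    by (rule eval_Comp1[OF eval_Comp1[OF eval_double_prog eval_Succ] eval_Oracle])
  then show ?thesis unfolding computable_def by auto
qed

definition bpair_opt :: "baire option \<Rightarrow> baire option \<Rightarrow> baire option" where
  "bpair_opt a b = Option.bind a (\<lambda>p. map_option (bpair p) b)"

lemma bpair_opt_eq_Some_iff:
  "bpair_opt a b = Some r \<longleftrightarrow> a = Some (bfst r) \<and> b = Some (bsnd r)"
  by (auto simp: bpair_opt_def bind_eq_Some_conv)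

lemma bpair_opt_Some [simp]: "bpair_opt (Some p) (Some q) = Some (bpair p q)"
  by (simp add: bpair_opt_def)

text \<open>
  The program may run both components at every argument before selecting one result,
  because both results exist wherever the pair is defined.
\<close>

lemma computable_bpair_opt:
  assumes "computable F" and "computable G"
  shows "computable (\<lambda>r. bpair_opt (F r) (G r))"
proof -
  obtain e where e: "\<And>p q n. F p = Some q \<Longrightarrow> eval p e [n] (q n)"
    using assms(1) unfolding computable_def by blast
  obtain d where d: "\<And>p q n. G p = Some q \<Longrightarrow> eval p d [n] (q n)"
    using assms(2) unfolding computable_def by blast
  let ?pair = "Comp select_prog [parity_prog, Comp e [half_prog], Comp d [half_prog]]"
  have "eval r ?pair [n] (s n)" if s: "bpair_opt (F r) (G r) = Some s" for r s n
  proof -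
    from s have "F r = Some (bfst s)" and "G r = Some (bsnd s)"
      by (simp_all add: bpair_opt_eq_Some_iff)
    then have "eval r (Comp e [half_prog]) [n] (bfst s (n div 2))"
      and "eval r (Comp d [half_prog]) [n] (bsnd s (n div 2))"
      by (auto intro: eval_Comp1 eval_half_prog e d)
    then have "eval r ?pair [n]
        (if n mod 2 = 0 then bfst s (n div 2) else bsnd s (n div 2))"
      by (rule eval_Comp3[OF eval_parity_prog _ _ eval_select_prog])
    also have "(if n mod 2 = 0 then bfst s (n div 2) else bsnd s (n div 2))
        = bpair (bfst s) (bsnd s) n"
      by (simp add: bpair_def even_iff_mod_2_eq_zero)
    finally show ?thesis by simp
  qed
  then show ?thesis unfolding computable_def by blast
qed

lemma computable_bpair:
  assumes "computable (\<lambda>r. Some (a r))" and "computable (\<lambda>r. Some (b r))"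
  shows "computable (\<lambda>r. Some (bpair (a r) (b r)))"
  using computable_bpair_opt[OF assms] by simp

lemma computable_precomp:
  assumes "computable F" and "computable (\<lambda>r. Some (a r))"
  shows "computable (\<lambda>r. F (a r))"
  using computable_map_comp[OF assms] by (simp add: map_comp_def)


section \<open>Reductions name by name\<close>

lemma ex_realizer_halting_only_on_names:
  assumes "represented_space V" and "mv_function U V g"
  obtains G where "realizer U V g G"
    and "\<And>k q. G k = Some q \<Longrightarrow> \<exists>u. rep U k = Some u \<and> u \<in> mv_dom g"
proof -
  define G where "G k = (if \<exists>u. rep U k = Some u \<and> u \<in> mv_dom g
      then Some (SOME q. \<exists>v. rep V q = Some v \<and> v \<in> g (the (rep U k))) else None)" for k
  have answer: "\<exists>q v. rep V q = Some v \<and> v \<in> g u" if u: "u \<in> mv_dom g" for u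
  proof -
    from u obtain v where "v \<in> g u" by (auto simp: mv_dom_def)
    moreover from this have "v \<in> ran (rep V)"
      using assms by (auto simp: represented_space_def mv_function_def)
    ultimately show ?thesis by (auto simp: ran_def)
  qed
  have "\<exists>v. rep V (SOME q. \<exists>v. rep V q = Some v \<and> v \<in> g u) = Some v \<and> v \<in> g u"
    if "u \<in> mv_dom g" for u
    using answer[OF that] by (rule someI_ex)
  then have "realizer U V g G"
    by (auto simp: realizer_def G_def)
  moreover have "\<exists>u. rep U k = Some u \<and> u \<in> mv_dom g" if "G k = Some q" for k q
    using that by (auto simp: G_def split: if_splits)
  ultimately show ?thesis using that by blast
qed

lemma ex_realizer_with_answer:
  assumes "represented_space V" and "mv_function U V g"
    and "rep U k = Some u" and "rep V q = Some v" and "v \<in> g u"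
  obtains G where "realizer U V g G" and "G k = Some q"
proof -
  obtain G where "realizer U V g G"
    using ex_realizer_halting_only_on_names[OF assms(1,2)] by blast
  then have "realizer U V g (G(k \<mapsto> q))"
    using assms(3-5) by (auto simp: realizer_def)
  then show ?thesis using that by simp
qed

text \<open>
  The post-processor takes the original name as an extra argument, so that both kinds of
  reducibility are instances: the ordinary kind with \<open>\<lambda>p q. H (bpair p q)\<close>, the strong
  kind with \<open>\<lambda>p. H\<close>.
\<close>

definition namewise_reduction ::
    "'a rspace \<Rightarrow> 'b rspace \<Rightarrow> ('a \<Rightarrow> 'b set) \<Rightarrow>
     'c rspace \<Rightarrow> 'd rspace \<Rightarrow> ('c \<Rightarrow> 'd set) \<Rightarrow>
     (baire \<Rightarrow> baire \<rightharpoonup> baire) \<Rightarrow> (baire \<rightharpoonup> baire) \<Rightarrow> bool" where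
  "namewise_reduction X Y f U V g \<Phi> K \<longleftrightarrow>
    (\<forall>p x. rep X p = Some x \<and> x \<in> mv_dom f \<longrightarrow>
      (\<exists>k u. K p = Some k \<and> rep U k = Some u \<and> u \<in> mv_dom g \<and>
        (\<forall>q v. rep V q = Some v \<and> v \<in> g u \<longrightarrow>
          (\<exists>r y. \<Phi> p q = Some r \<and> rep Y r = Some y \<and> y \<in> f x))))"

text \<open>
  From left to right: a realizer that halts only on names of points of the domain forces
  \<open>K p\<close> to be such a name, as the composite has to halt at \<open>p\<close>; given this, a realizer that
  answers \<open>q\<close> at \<open>K p\<close> tests the post-processor on \<open>q\<close>.
\<close>

lemma transforms_realizers_iff:
  assumes V: "represented_space V" and g: "mv_function U V g"
  shows "(\<forall>G. realizer U V g G \<longrightarrow> realizer X Y f (\<lambda>p. Option.bind ((G \<circ>\<^sub>m K) p) (\<Phi> p)))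
    \<longleftrightarrow> namewise_reduction X Y f U V g \<Phi> K"
    (is "?L \<longleftrightarrow> ?R")
proof
  assume L: ?L
  show ?R
    unfolding namewise_reduction_def
  proof (intro allI impI)
    fix p x assume p: "rep X p = Some x \<and> x \<in> mv_dom f"
    have answer: "\<exists>k q r y. K p = Some k \<and> G k = Some q \<and> \<Phi> p q = Some r
        \<and> rep Y r = Some y \<and> y \<in> f x" if "realizer U V g G" for G
      using L that p unfolding realizer_def[of X]
      by (fastforce simp: bind_eq_Some_conv map_comp_Some_iff)
    obtain G where G: "realizer U V g G"
      "\<And>k q. G k = Some q \<Longrightarrow> \<exists>u. rep U k = Some u \<and> u \<in> mv_dom g"
      using ex_realizer_halting_only_on_names[OF V g] by blast
    from answer[OF G(1)] G(2) obtain k u where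
      k: "K p = Some k" "rep U k = Some u" "u \<in> mv_dom g"
      by blast
    have "\<exists>r y. \<Phi> p q = Some r \<and> rep Y r = Some y \<and> y \<in> f x"
      if q: "rep V q = Some v \<and> v \<in> g u" for q v
    proof -
      obtain G' where "realizer U V g G'" "G' k = Some q"
        using ex_realizer_with_answer[OF V g k(2)] q by blast
      with answer[of G'] k(1) show ?thesis by auto
    qed
    with k show "\<exists>k u. K p = Some k \<and> rep U k = Some u \<and> u \<in> mv_dom g \<and>
        (\<forall>q v. rep V q = Some v \<and> v \<in> g u \<longrightarrow>
          (\<exists>r y. \<Phi> p q = Some r \<and> rep Y r = Some y \<and> y \<in> f x))"
      by blast
  qed
next
  assume R: ?R
  show ?L
  proof (intro allI impI)
    fix G assume G: "realizer U V g G"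
    show "realizer X Y f (\<lambda>p. Option.bind ((G \<circ>\<^sub>m K) p) (\<Phi> p))"
      unfolding realizer_def[of X]
    proof (intro allI impI)
      fix p x assume "rep X p = Some x \<and> x \<in> mv_dom f"
      with R obtain k u where k: "K p = Some k" "rep U k = Some u \<and> u \<in> mv_dom g"
        and post: "\<And>q v. rep V q = Some v \<and> v \<in> g u \<Longrightarrow>
          \<exists>r y. \<Phi> p q = Some r \<and> rep Y r = Some y \<and> y \<in> f x"
        unfolding namewise_reduction_def by blast
      from G k(2) obtain q v where q: "G k = Some q" "rep V q = Some v \<and> v \<in> g u"
        unfolding realizer_def by blast
      from post[OF q(2)] k(1) q(1)
      show "\<exists>r y. Option.bind ((G \<circ>\<^sub>m K) p) (\<Phi> p) = Some r \<and> rep Y r = Some y \<and> y \<in> f x"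
        by simp
    qed
  qed
qed

lemma weihrauch_le_iff_namewise:
  assumes "represented_space V" and "mv_function U V g"
  shows "weihrauch_le X Y f U V g \<longleftrightarrow>
    (\<exists>H K. computable H \<and> computable K \<and>
      namewise_reduction X Y f U V g (\<lambda>p q. H (bpair p q)) K)"
proof -
  have composite: "H \<circ>\<^sub>m (\<lambda>p. map_option (bpair p) ((G \<circ>\<^sub>m K) p))
      = (\<lambda>p. Option.bind ((G \<circ>\<^sub>m K) p) (\<lambda>q. H (bpair p q)))" for H G K
    by (auto simp: map_comp_def fun_eq_iff split: option.split)
  show ?thesis
    unfolding weihrauch_le_def transforms_realizers_iff[OF assms, symmetric] composite ..
qed

lemma strong_weihrauch_le_iff_namewise:
  assumes "represented_space V" and "mv_function U V g"
  shows "strong_weihrauch_le X Y f U V g \<longleftrightarrow>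
    (\<exists>H K. computable H \<and> computable K \<and> namewise_reduction X Y f U V g (\<lambda>p. H) K)"
proof -
  have composite: "H \<circ>\<^sub>m G \<circ>\<^sub>m K = (\<lambda>p. Option.bind ((G \<circ>\<^sub>m K) p) H)" for H G K
    by (auto simp: map_comp_def fun_eq_iff split: option.split)
  show ?thesis
    unfolding strong_weihrauch_le_def transforms_realizers_iff[OF assms, symmetric] composite ..
qed


section \<open>Products\<close>

lemma rep_prod_space_eq_Some_iff:
  "rep (prod_space X U) r = Some (x, u) \<longleftrightarrow> rep X (bfst r) = Some x \<and> rep U (bsnd r) = Some u"
  using rep_prod_space_bpair[of X U "bfst r" "bsnd r"] by simp

lemma namewise_reduction_prod:
  assumes "namewise_reduction X Y f U V g \<Phi> K"
    and "namewise_reduction X' Y' f' U' V' g' \<Phi>' K'"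
  shows "namewise_reduction (prod_space X X') (prod_space Y Y') (mv_prod f f')
    (prod_space U U') (prod_space V V') (mv_prod g g')
    (\<lambda>p q. bpair_opt (\<Phi> (bfst p) (bfst q)) (\<Phi>' (bsnd p) (bsnd q)))
    (\<lambda>p. bpair_opt (K (bfst p)) (K' (bsnd p)))"
  unfolding namewise_reduction_def
proof (intro allI impI)
  fix p and z :: "'a \<times> 'e"
  assume p: "rep (prod_space X X') p = Some z \<and> z \<in> mv_dom (mv_prod f f')"
  obtain x x' where z: "z = (x, x')" by (cases z)
  with p have p_x: "rep X (bfst p) = Some x \<and> x \<in> mv_dom f"
    and p_x': "rep X' (bsnd p) = Some x' \<and> x' \<in> mv_dom f'"
    by (auto simp: rep_prod_space_eq_Some_iff mv_dom_mv_prod)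
  obtain k u where k: "K (bfst p) = Some k" "rep U k = Some u" "u \<in> mv_dom g"
    and post: "\<And>q v. rep V q = Some v \<and> v \<in> g u \<Longrightarrow>
      \<exists>r y. \<Phi> (bfst p) q = Some r \<and> rep Y r = Some y \<and> y \<in> f x"
    using assms(1) p_x unfolding namewise_reduction_def by blast
  obtain k' u' where k': "K' (bsnd p) = Some k'" "rep U' k' = Some u'" "u' \<in> mv_dom g'"
    and post': "\<And>q v. rep V' q = Some v \<and> v \<in> g' u' \<Longrightarrow>
      \<exists>r y. \<Phi>' (bsnd p) q = Some r \<and> rep Y' r = Some y \<and> y \<in> f' x'"
    using assms(2) p_x' unfolding namewise_reduction_def by blast
  have "\<exists>r y. bpair_opt (\<Phi> (bfst p) (bfst q)) (\<Phi>' (bsnd p) (bsnd q)) = Some r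
      \<and> rep (prod_space Y Y') r = Some y \<and> y \<in> mv_prod f f' z"
    if q: "rep (prod_space V V') q = Some w \<and> w \<in> mv_prod g g' (u, u')" for q w
  proof -
    obtain v v' where w: "w = (v, v')" by (cases w)
    with q have "rep V (bfst q) = Some v \<and> v \<in> g u"
      and "rep V' (bsnd q) = Some v' \<and> v' \<in> g' u'"
      by (auto simp: rep_prod_space_eq_Some_iff mv_prod_def)
    from post[OF this(1)] post'[OF this(2)] obtain r y r' y' where
      "\<Phi> (bfst p) (bfst q) = Some r" "rep Y r = Some y" "y \<in> f x"
      "\<Phi>' (bsnd p) (bsnd q) = Some r'" "rep Y' r' = Some y'" "y' \<in> f' x'"
      by blast
    then show ?thesis
      using z by (intro exI[of _ "bpair r r'"] exI[of _ "(y, y')"])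
        (simp add: rep_prod_space_bpair mv_prod_def)
  qed
  moreover have "bpair_opt (K (bfst p)) (K' (bsnd p)) = Some (bpair k k')"
    and "rep (prod_space U U') (bpair k k') = Some (u, u')"
    and "(u, u') \<in> mv_dom (mv_prod g g')"
    using k k' by (simp_all add: rep_prod_space_bpair mv_dom_mv_prod)
  ultimately show "\<exists>k u. bpair_opt (K (bfst p)) (K' (bsnd p)) = Some k
      \<and> rep (prod_space U U') k = Some u \<and> u \<in> mv_dom (mv_prod g g') \<and>
      (\<forall>q v. rep (prod_space V V') q = Some v \<and> v \<in> mv_prod g g' u \<longrightarrow>
        (\<exists>r y. bpair_opt (\<Phi> (bfst p) (bfst q)) (\<Phi>' (bsnd p) (bsnd q)) = Some r
          \<and> rep (prod_space Y Y') r = Some y \<and> y \<in> mv_prod f f' z))"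
    by blast
qed

lemma computable_parallel:
  assumes "computable F" and "computable F'"
  shows "computable (\<lambda>r. bpair_opt (F (bfst r)) (F' (bsnd r)))"
  by (rule computable_bpair_opt[OF computable_precomp[OF assms(1) computable_bfst]
        computable_precomp[OF assms(2) computable_bsnd]])

theorem proposition3p2:
  fixes X :: "'x rspace" and Y :: "'y rspace" and f :: "'x \<Rightarrow> 'y set"
    and X' :: "'x1 rspace" and Y' :: "'y1 rspace" and f' :: "'x1 \<Rightarrow> 'y1 set"
    and U :: "'u rspace" and V :: "'v rspace" and g :: "'u \<Rightarrow> 'v set"
    and U' :: "'u1 rspace" and V' :: "'v1 rspace" and g' :: "'u1 \<Rightarrow> 'v1 set"
  assumes "represented_space X" and "represented_space Y" and "mv_function X Y f"
    and "represented_space X'" and "represented_space Y'" and "mv_function X' Y' f'"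
    and "represented_space U" and "represented_space V" and "mv_function U V g"
    and "represented_space U'" and "represented_space V'" and "mv_function U' V' g'"
  shows "(weihrauch_le X Y f U V g \<and> weihrauch_le X' Y' f' U' V' g' \<longrightarrow>
      weihrauch_le (prod_space X X') (prod_space Y Y') (mv_prod f f')
        (prod_space U U') (prod_space V V') (mv_prod g g'))
    \<and> (strong_weihrauch_le X Y f U V g \<and> strong_weihrauch_le X' Y' f' U' V' g' \<longrightarrow>
      strong_weihrauch_le (prod_space X X') (prod_space Y Y') (mv_prod f f')
        (prod_space U U') (prod_space V V') (mv_prod g g'))"
proof (intro conjI impI)
  note V = represented_space_prod_space[OF assms(8,11)]
    and g = mv_function_mv_prod[OF assms(9,12)]
  {
    assume "weihrauch_le X Y f U V g \<and> weihrauch_le X' Y' f' U' V' g'"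
    then obtain H K H' K' where
      comp: "computable H" "computable K" "computable H'" "computable K'"
      and red: "namewise_reduction X Y f U V g (\<lambda>p q. H (bpair p q)) K"
        "namewise_reduction X' Y' f' U' V' g' (\<lambda>p q. H' (bpair p q)) K'"
      unfolding weihrauch_le_iff_namewise[OF assms(8,9)] weihrauch_le_iff_namewise[OF assms(11,12)]
      by blast
    \<comment> \<open>The input \<open>\<langle>\<langle>p, p'\<rangle>, \<langle>q, q'\<rangle>\<rangle>\<close> is regrouped into \<open>\<langle>p, q\<rangle>\<close> and \<open>\<langle>p', q'\<rangle>\<close>.\<close>
    define L where "L s = bpair_opt (H (bpair (bfst (bfst s)) (bfst (bsnd s))))
        (H' (bpair (bsnd (bfst s)) (bsnd (bsnd s))))" for s
    have fst_regroup: "computable (\<lambda>s. Some (bpair (bfst (bfst s)) (bfst (bsnd s))))"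
      by (rule computable_bpair[OF computable_precomp[OF computable_bfst computable_bfst]
            computable_precomp[OF computable_bfst computable_bsnd]])
    have snd_regroup: "computable (\<lambda>s. Some (bpair (bsnd (bfst s)) (bsnd (bsnd s))))"
      by (rule computable_bpair[OF computable_precomp[OF computable_bsnd computable_bfst]
            computable_precomp[OF computable_bsnd computable_bsnd]])
    have "computable L"
      unfolding L_def
      by (rule computable_bpair_opt[OF computable_precomp[OF comp(1) fst_regroup]
            computable_precomp[OF comp(3) snd_regroup]])
    moreover note computable_parallel[OF comp(2,4)]
    moreover have "namewise_reduction (prod_space X X') (prod_space Y Y') (mv_prod f f')
        (prod_space U U') (prod_space V V') (mv_prod g g') (\<lambda>p q. L (bpair p q))
        (\<lambda>p. bpair_opt (K (bfst p)) (K' (bsnd p)))"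
      using namewise_reduction_prod[OF red] by (simp add: L_def)
    ultimately show "weihrauch_le (prod_space X X') (prod_space Y Y') (mv_prod f f')
        (prod_space U U') (prod_space V V') (mv_prod g g')"
      unfolding weihrauch_le_iff_namewise[OF V g] by blast
  next
    assume "strong_weihrauch_le X Y f U V g \<and> strong_weihrauch_le X' Y' f' U' V' g'"
    then obtain H K H' K' where
      comp: "computable H" "computable K" "computable H'" "computable K'"
      and red: "namewise_reduction X Y f U V g (\<lambda>p. H) K"
        "namewise_reduction X' Y' f' U' V' g' (\<lambda>p. H') K'"
      unfolding strong_weihrauch_le_iff_namewise[OF assms(8,9)]
        strong_weihrauch_le_iff_namewise[OF assms(11,12)]
      by blast
    from computable_parallel[OF comp(1,3)] computable_parallel[OF comp(2,4)]
      namewise_reduction_prod[OF red]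
    show "strong_weihrauch_le (prod_space X X') (prod_space Y Y') (mv_prod f f')
        (prod_space U U') (prod_space V V') (mv_prod g g')"
      unfolding strong_weihrauch_le_iff_namewise[OF V g] by blast
  }
qed

end
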